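(* Fix a finite state space $\mathcal{X}=\{0,1,\dots,d\}$, a distribution $\pi\in\mathcal{P}$ and a functional $\mathfrak{F}:\mathcal{P}\to\mathbb{R}$ of class $C^2$. Suppose that, for every generator $Q$ defining an irreducible time-reversible Markov chain with state space $\mathcal{X}$ and stationary distribution $\pi$, there exists a Riemannian metric $g$ of class $C^1$ on $\mathcal{P}$ such that the gradient flow of $\mathfrak{F}$ under the metric $g$ equals the flow associated to the semigroup $e^{tQ}$. Then there exists a positive constant $\alpha$ such that $$\mathrm{d}\mathfrak{F}|_{\pi}=\mathrm{d}\mathfrak{H}|_{\pi}=0\quad\text{and}\quad \mathrm{d}^2\mathfrak{F}|_{\pi}=\alpha\,\mathrm{d}^2\mathfrak{H}|_{\pi},$$ where $\mathfrak{H}$ is the relative entropy with respect to $\pi$.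
   Context: State space: $\mathcal{X}=\{0,1,\dots,d\}$. A generator is a matrix $Q\in\mathbb{R}^{\mathcal{X}\times\mathcal{X}}$ where for $i\neq j$ the entry $Q_{ij}\ge 0$ is the transition rate from $i$ to $j$, and $Q_{ii}=-\sum_{j\neq i}Q_{ij}$. Probability distributions are row vectors and matrices act on them from the right: with initial law $\mu$ the law at time $t$ is $\mu e^{tQ}$. An irreducible chain has a unique stationary distribution $\pi$ ($\pi Q=0$). The chain is time-reversible if it satisfies detailed balance $\pi_iQ_{ij}=\pi_jQ_{ji}$ for all $i,j\in\mathcal{X}$. $\mathcal{P}$ is the set of probability distributions on $\mathcal{X}$ with positive mass at every state, viewed as the $d$-dimensional submanifold $\{v\in\mathbb{R}^{\mathcal{X}}:\sum_{i}v_i=1,\ v_i>0\ \forall i\}$ of $\mathbb{R}^{\mathcal{X}}$. Its tangent space at any point is identified with $T=\{v\in\mathbb{R}^{\mathcal{X}}:\sum_{i}v_i=0\}$. A Riemannian metric $g$ on $\mathcal{P}$ assigns to each $\mu\in\mathcal{P}$ an inner product $g|_\mu$ on $T$; it is of class $C^1$ if $\mu\mapsto g|_\mu(v,w)$ is $C^1$ for all $v,w\in T$. $\mathrm{d}\mathfrak{F}|_\pi:T\to\mathbb{R}$ denotes the first derivative of $\mathfrak{F}$ at $\pi$ (a linear map) and $\mathrm{d}^2\mathfrak{F}|_\pi:T\times T\to\mathbb{R}$ the second derivative at $\pi$ (a bilinear form). Given a functional $\mathfrak{F}:\mathcal{P}\to\mathbb{R}$ and a Riemannian metric $g$, a gradient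 flow $\rho:[0,\infty)\to\mathcal{P}$ of $\mathfrak{F}$ under $g$ is determined by $g|_{\rho(t)}(\dot\rho(t),v)=-\mathrm{d}\mathfrak{F}|_{\rho(t)}(v)$ for all $v\in T$ and $t\ge 0$. The gradient flow of $\mathfrak{F}$ under $g$ equals the flow associated to the semigroup $e^{tQ}$ if for every $\mu\in\mathcal{P}$ the trajectory $t\mapsto\mu e^{tQ}$ is the gradient flow $\rho(t)$ with $\rho(0)=\mu$. The relative entropy with respect to $\pi$ is $\mathfrak{H}(\rho)=-\sum_{i\in\mathcal{X}}\rho_i\log\frac{\pi_i}{\rho_i}$ for $\rho\in\mathcal{P}$. *)

theory Defs
  imports "HOL-Analysis.Analysis"
begin

text \<open>
  The state space is an arbitrary finite type \<open>'n\<close> (with \<open>CARD('n) = d + 1\<close>).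
  Distributions are row vectors, so a matrix acts on them through \<^term>\<open>(v*)\<close>.
\<close>

section \<open>The manifold of positive distributions\<close>

definition prob_manifold :: "(real ^ 'n) set" where
  "prob_manifold = {v. (\<Sum>i\<in>UNIV. v $ i) = 1 \<and> (\<forall>i. v $ i > 0)}"

definition tangent_space :: "(real ^ 'n) set" where
  "tangent_space = {v. (\<Sum>i\<in>UNIV. v $ i) = 0}"

text \<open>
  The manifold is relatively open in its affine hull, so the Frechet derivative within it is
  uniquely determined on the tangent space; it is arbitrary in the transversal direction. The
  two derivatives below are therefore meaningful for tangent vectors only. Likewise, functionals
  are total functions whose values off the manifold are irrelevant.
\<close>

definition differential :: "(real ^ 'n \<Rightarrow> real) \<Rightarrow> real ^ 'n \<Rightarrow> real ^ 'n \<Rightarrow> real" where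
  "differential F \<mu> = frechet_derivative F (at \<mu> within prob_manifold)"

definition second_differential ::
    "(real ^ 'n \<Rightarrow> real) \<Rightarrow> real ^ 'n \<Rightarrow> real ^ 'n \<Rightarrow> real ^ 'n \<Rightarrow> real" where
  "second_differential F \<mu> v w = differential (\<lambda>\<nu>. differential F \<nu> w) \<mu> v"

primrec class_C :: "nat \<Rightarrow> (real ^ 'n \<Rightarrow> real) \<Rightarrow> bool" where
  "class_C 0 F \<longleftrightarrow> continuous_on prob_manifold F"
| "class_C (Suc k) F \<longleftrightarrow> F differentiable_on prob_manifold \<and>
     (\<forall>v\<in>tangent_space. class_C k (\<lambda>\<mu>. differential F \<mu> v))"

section \<open>Riemannian metrics and gradient flows\<close>

definition inner_product_on ::
    "'a::real_vector set \<Rightarrow> ('a \<Rightarrow> 'a \<Rightarrow> real) \<Rightarrow> bool" where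
  "inner_product_on V B \<longleftrightarrow>
     (\<forall>u\<in>V. \<forall>v\<in>V. \<forall>w\<in>V. B (u + v) w = B u w + B v w) \<and>
     (\<forall>c. \<forall>v\<in>V. \<forall>w\<in>V. B (c *\<^sub>R v) w = c * B v w) \<and>
     (\<forall>v\<in>V. \<forall>w\<in>V. B v w = B w v) \<and>
     (\<forall>v\<in>V. v \<noteq> 0 \<longrightarrow> B v v > 0)"

definition riemannian_metric ::
    "(real ^ 'n \<Rightarrow> real ^ 'n \<Rightarrow> real ^ 'n \<Rightarrow> real) \<Rightarrow> bool" where
  "riemannian_metric g \<longleftrightarrow> (\<forall>\<mu>\<in>prob_manifold. inner_product_on tangent_space (g \<mu>))"

definition metric_class_C ::
    "nat \<Rightarrow> (real ^ 'n \<Rightarrow> real ^ 'n \<Rightarrow> real ^ 'n \<Rightarrow> real) \<Rightarrow> bool" where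
  "metric_class_C k g \<longleftrightarrow> (\<forall>v\<in>tangent_space. \<forall>w\<in>tangent_space. class_C k (\<lambda>\<mu>. g \<mu> v w))"

definition gradient_flow ::
    "(real ^ 'n \<Rightarrow> real) \<Rightarrow> (real ^ 'n \<Rightarrow> real ^ 'n \<Rightarrow> real ^ 'n \<Rightarrow> real) \<Rightarrow>
     (real \<Rightarrow> real ^ 'n) \<Rightarrow> bool" where
  "gradient_flow F g \<rho> \<longleftrightarrow>
     (\<forall>t\<ge>0. \<rho> t \<in> prob_manifold) \<and>
     (\<forall>t\<ge>0. \<exists>\<rho>'. (\<rho> has_vector_derivative \<rho>') (at t within {0..}) \<and>
        (\<forall>v\<in>tangent_space. g (\<rho> t) \<rho>' v = - differential F (\<rho> t) v))"

section \<open>Markov chains\<close>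

definition generator :: "real ^ 'n ^ 'n \<Rightarrow> bool" where
  "generator Q \<longleftrightarrow>
     (\<forall>i j. i \<noteq> j \<longrightarrow> Q $ i $ j \<ge> 0) \<and>
     (\<forall>i. Q $ i $ i = - (\<Sum>j\<in>UNIV - {i}. Q $ i $ j))"

definition irreducible_generator :: "real ^ 'n ^ 'n \<Rightarrow> bool" where
  "irreducible_generator Q \<longleftrightarrow> (\<forall>i j. (i, j) \<in> {(k, l). k \<noteq> l \<and> Q $ k $ l > 0}\<^sup>*)"

definition stationary :: "real ^ 'n \<Rightarrow> real ^ 'n ^ 'n \<Rightarrow> bool" where
  "stationary \<pi> Q \<longleftrightarrow> \<pi> v* Q = 0"

definition detailed_balance :: "real ^ 'n \<Rightarrow> real ^ 'n ^ 'n \<Rightarrow> bool" where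
  "detailed_balance \<pi> Q \<longleftrightarrow> (\<forall>i j. \<pi> $ i * Q $ i $ j = \<pi> $ j * Q $ j $ i)"

text \<open>
  The type \<^typ>\<open>real ^ 'n ^ 'n\<close> is not an instance of the normed algebra classes, so the
  overloaded \<^const>\<open>exp\<close> is unavailable and the matrix exponential is spelled out as its series.
\<close>

definition matrix_exp :: "real ^ 'n ^ 'n \<Rightarrow> real ^ 'n ^ 'n" where
  "matrix_exp A = (\<Sum>k. (1 / fact k) *\<^sub>R (((**) A ^^ k) (mat 1)))"

definition gradient_flow_equals_semigroup ::
    "(real ^ 'n \<Rightarrow> real) \<Rightarrow> (real ^ 'n \<Rightarrow> real ^ 'n \<Rightarrow> real ^ 'n \<Rightarrow> real) \<Rightarrow>
     real ^ 'n ^ 'n \<Rightarrow> bool" where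
  "gradient_flow_equals_semigroup F g Q \<longleftrightarrow>
     (\<forall>\<mu>\<in>prob_manifold. gradient_flow F g (\<lambda>t. \<mu> v* matrix_exp (t *\<^sub>R Q)))"

definition relative_entropy :: "real ^ 'n \<Rightarrow> real ^ 'n \<Rightarrow> real" where
  "relative_entropy \<pi> \<rho> = - (\<Sum>i\<in>UNIV. \<rho> $ i * ln (\<pi> $ i / \<rho> $ i))"

end

theory Submission
  imports Defs
begin

text \<open>
  Write \<open>B\<close> for the second differential of \<open>F\<close> at \<open>\<pi>\<close> and \<open>\<langle>u, w\<rangle> = (\<Sum>i. u\<^sub>i w\<^sub>i / \<pi>\<^sub>i)\<close>, which is
  the second differential of the relative entropy at \<open>\<pi>\<close>.

  Evaluating the flow equation at time \<open>0\<close>, where \<open>\<mu> e\<^sup>t\<^sup>Q\<close> has velocity \<open>\<mu>Q\<close>, turns the hypothesis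
  into an identity on the whole manifold: \<open>g\<^sub>\<mu>(\<mu>Q, v) = - dF\<^sub>\<mu>(v)\<close>. At \<open>\<mu> = \<pi>\<close> the left-hand side
  vanishes, so \<open>dF\<^sub>\<pi> = 0\<close>. At \<open>\<mu> = \<pi> + su\<close> the velocity is \<open>s \<cdot> uQ\<close>; dividing by \<open>s\<close> and letting
  \<open>s \<rightarrow> 0\<close> gives \<open>g\<^sub>\<pi>(uQ, v) = - B(u, v)\<close>
  (\<open>metric_at_stationary_point\<close>). Hence \<open>B(u, vQ) = - g\<^sub>\<pi>(uQ, vQ)\<close> is symmetric in \<open>u\<close> and \<open>v\<close>.
  The metric depends on \<open>Q\<close> but \<open>B\<close> does not, so this symmetry holds for every reversible \<open>Q\<close>
  simultaneously, and it remains to choose enough generators.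

  A sufficient family consists of the rank-one perturbations of the chain that jumps to a
  \<open>\<pi>\<close>-distributed state at constant rate: for \<open>w\<close> tangent and \<open>K\<close> large there is an admissible \<open>Q\<close>
  with \<open>uQ = - K u + \<langle>u, w\<rangle> w\<close> on the tangent space. For \<open>w = 0\<close> and \<open>K = 1\<close> this yields \<open>B = g\<^sub>\<pi>\<close>,
  so \<open>B\<close> is an inner product, and in particular symmetric.
  For general \<open>w\<close> the terms with \<open>K\<close> cancel and leave \<open>\<langle>v, w\<rangle> B(u, w) = \<langle>u, w\<rangle> B(v, w)\<close>. By
  \<open>inner_products_proportional\<close> two inner products related in this way are proportional.
\<close>

section \<open>Inner products on the tangent space\<close>

lemma subspace_tangent_space: "subspace tangent_space"
  by (auto simp: subspace_def tangent_space_def sum.distrib simp flip: sum_distrib_left)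

lemma inner_product_on_laws:
  assumes "inner_product_on V B" "subspace V" "u \<in> V" "v \<in> V" "w \<in> V"
  shows "B (u + v) w = B u w + B v w"
    and "B w (u + v) = B w u + B w v"
    and "B (c *\<^sub>R u) w = c * B u w"
    and "B w (c *\<^sub>R u) = c * B w u"
    and "B u w = B w u"
    and "B 0 w = 0"
proof -
  note B = assms(1)[unfolded inner_product_on_def]
  note add = B[THEN conjunct1, rule_format]
  note scale = B[THEN conjunct2, THEN conjunct1, rule_format]
  note sym = B[THEN conjunct2, THEN conjunct2, THEN conjunct1, rule_format]
  show "B (u + v) w = B u w + B v w" "B (c *\<^sub>R u) w = c * B u w" "B u w = B w u"
    by (fact add[OF assms(3-5)] scale[OF assms(3,5)] sym[OF assms(3,5)])+
  show "B w (u + v) = B w u + B w v"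
    using add[of u v w] sym[of w "u + v"] sym[of w u] sym[of w v] assms(3-5)
      subspace_add[OF assms(2-4)] by simp
  show "B w (c *\<^sub>R u) = c * B w u"
    using scale[of u w c] sym[of w "c *\<^sub>R u"] sym[of w u] assms(3-5)
      subspace_scale[OF assms(2,3)] by simp
  show "B 0 w = 0"
    using scale[of u w 0] assms(3-5) by simp
qed

lemma inner_product_on_cong:
  assumes A: "inner_product_on V A" and V: "subspace V"
    and eq: "\<And>u v. u \<in> V \<Longrightarrow> v \<in> V \<Longrightarrow> B u v = A u v"
  shows "inner_product_on V B"
  unfolding inner_product_on_def
proof (intro conjI ballI allI impI)
  note laws = inner_product_on_laws[OF A V] and closed = subspace_add[OF V] subspace_scale[OF V]
  show "B (u + v) w = B u w + B v w" if "u \<in> V" "v \<in> V" "w \<in> V" for u v w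
    using laws(1)[OF that] that by (simp add: eq closed)
  show "B (c *\<^sub>R v) w = c * B v w" if "v \<in> V" "w \<in> V" for c v w
    using laws(3)[OF that(1,1,2)] that by (simp add: eq closed)
  show "B v w = B w v" if "v \<in> V" "w \<in> V" for v w
    using laws(5)[OF that(1,1,2)] that by (simp add: eq)
  show "B v v > 0" if "v \<in> V" "v \<noteq> 0" for v
    using A that by (simp add: eq inner_product_on_def)
qed

text \<open>
  The hypothesis says that the functionals \<open>B(\<cdot>, w)\<close> and \<open>A(\<cdot>, w)\<close> are parallel for each \<open>w\<close>; only
  the independence of the factor from \<open>w\<close> has to be shown. Normalising at one vector \<open>e\<close>, the
  difference \<open>B - \<alpha> A\<close> inherits the hypothesis and has \<open>e\<close> in its kernel; polarising the hypothesis
  between \<open>w\<close> and \<open>w + e\<close> shows that this kernel is everything.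
\<close>

lemma inner_products_proportional:
  assumes V: "subspace V" and A: "inner_product_on V A" and B: "inner_product_on V B"
    and parallel: "\<And>u v w. u \<in> V \<Longrightarrow> v \<in> V \<Longrightarrow> w \<in> V \<Longrightarrow> A v w * B u w = A u w * B v w"
  shows "\<exists>\<alpha>>0. \<forall>u\<in>V. \<forall>w\<in>V. B u w = \<alpha> * A u w"
proof (cases "\<exists>e\<in>V. e \<noteq> 0")
  case False
  have "B u w = 1 * A u w" if "u \<in> V" "w \<in> V" for u w
  proof -
    have "u = 0" "w = 0"
      using False that by blast+
    then show ?thesis
      using inner_product_on_laws(6)[OF A V] inner_product_on_laws(6)[OF B V] subspace_0[OF V]
      by simp
  qed
  then show ?thesis
    using zero_less_one by blast
next
  case True
  then obtain e where e: "e \<in> V" "e \<noteq> 0" by blast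
  have pos: "A e e > 0" "B e e > 0"
    using A B e unfolding inner_product_on_def by blast+
  define \<alpha> where "\<alpha> = B e e / A e e"
  define D where "D u w = B u w - \<alpha> * A u w" for u w
  note A_laws = inner_product_on_laws[OF A V] and B_laws = inner_product_on_laws[OF B V]
  have D_kernel: "D u e = 0" if "u \<in> V" for u
    using parallel[of u e e] that e pos by (simp add: D_def \<alpha>_def field_simps)
  have D_sym: "D u w = D w u" if "u \<in> V" "w \<in> V" for u w
    using A_laws(5)[of u u w] B_laws(5)[of u u w] that by (simp add: D_def)
  have D_parallel: "A v w * D u w = A u w * D v w" if "u \<in> V" "v \<in> V" "w \<in> V" for u v w
    using parallel[OF that] by (simp add: D_def algebra_simps)
  have D_add: "D u (w + e) = D u w" if "u \<in> V" "w \<in> V" for u w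
    using D_kernel[OF that(1)] A_laws(2)[of w e u] B_laws(2)[of w e u] that e
    by (simp add: D_def algebra_simps)
  have "D u w = 0" if uw: "u \<in> V" "w \<in> V" for u w
  proof -
    have "A e (w + e) * D u w = A u (w + e) * D e w"
      using D_parallel[of u e "w + e"] D_add uw e subspace_add[OF V] by simp
    moreover have "A x (w + e) = A x w + A x e" if "x \<in> V" for x
      using A_laws(2)[of w e x] uw e that by simp
    ultimately have "A e e * D u w = A u e * D e w"
      using D_parallel[of u e w] uw e by (simp add: algebra_simps)
    also have "\<dots> = 0"
      using D_sym[of e w] D_kernel[of w] uw e by simp
    finally show ?thesis
      using pos by simp
  qed
  moreover have "\<alpha> > 0"
    using pos by (simp add: \<alpha>_def)
  ultimately show ?thesis
    unfolding D_def by (intro exI[of _ \<alpha>]) auto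
qed

text \<open>On tangent vectors this is the Fisher information metric at \<open>\<pi>\<close>.\<close>

definition weighted_inner :: "real ^ 'n \<Rightarrow> real ^ 'n \<Rightarrow> real ^ 'n \<Rightarrow> real" where
  "weighted_inner \<pi> v w = (\<Sum>i\<in>UNIV. v $ i * w $ i / \<pi> $ i)"

lemma inner_product_on_weighted_inner:
  fixes \<pi> :: "real ^ 'n"
  assumes "\<And>i. \<pi> $ i > 0"
  shows "inner_product_on V (weighted_inner \<pi>)"
proof -
  have definite: "weighted_inner \<pi> v v > 0" if v: "v \<noteq> 0" for v
  proof -
    obtain k where k: "v $ k \<noteq> 0"
      using v by (metis vec_eq_iff zero_index)
    have "v $ k * v $ k / \<pi> $ k > 0"
      using assms[of k] k not_real_square_gt_zero[of "v $ k"] by (metis divide_pos_pos)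
    moreover have "v $ i * v $ i / \<pi> $ i \<ge> 0" for i
      using assms[of i] by (simp add: less_imp_le)
    ultimately show ?thesis
      unfolding weighted_inner_def by (intro sum_pos2[where i = k]) auto
  qed
  have add: "weighted_inner \<pi> (u + v) w = weighted_inner \<pi> u w + weighted_inner \<pi> v w" for u v w
    by (simp add: weighted_inner_def distrib_right add_divide_distrib sum.distrib)
  have scale: "weighted_inner \<pi> (c *\<^sub>R v) w = c * weighted_inner \<pi> v w" for c v w
    by (simp add: weighted_inner_def sum_distrib_left mult.assoc)
  have sym: "weighted_inner \<pi> v w = weighted_inner \<pi> w v" for v w
    by (simp add: weighted_inner_def mult.commute)
  show ?thesis
    unfolding inner_product_on_def by (intro conjI ballI allI impI add scale sym definite)
qed

section \<open>Differentials along the manifold\<close>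

lemma eventually_line_in_manifold:
  fixes u :: "real ^ 'n"
  assumes "\<mu> \<in> prob_manifold" "u \<in> tangent_space"
  shows "\<forall>\<^sub>F s in at 0. \<mu> + s *\<^sub>R u \<in> prob_manifold"
proof -
  have "\<forall>\<^sub>F s in at 0. (\<mu> + s *\<^sub>R u) $ i > 0" for i
  proof (rule order_tendstoD)
    have "((\<lambda>s. \<mu> $ i + s * u $ i) \<longlongrightarrow> \<mu> $ i + 0 * u $ i) (at 0)"
      by (intro tendsto_intros)
    then show "((\<lambda>s. (\<mu> + s *\<^sub>R u) $ i) \<longlongrightarrow> \<mu> $ i) (at 0)"
      by simp
    show "\<mu> $ i > 0"
      using assms by (simp add: prob_manifold_def)
  qed
  then have "\<forall>\<^sub>F s in at 0. \<forall>i. (\<mu> + s *\<^sub>R u) $ i > 0"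
    by (simp add: eventually_all_finite)
  moreover have "(\<Sum>i\<in>UNIV. (\<mu> + s *\<^sub>R u) $ i) = 1" for s
    using assms by (simp add: prob_manifold_def tangent_space_def sum.distrib
        flip: sum_distrib_left)
  ultimately show ?thesis
    by (simp add: prob_manifold_def)
qed

lemma tendsto_along_line:
  fixes u :: "real ^ 'n"
  assumes "\<mu> \<in> prob_manifold" "u \<in> tangent_space"
    and "continuous (at \<mu> within prob_manifold) G"
  shows "((\<lambda>s. G (\<mu> + s *\<^sub>R u)) \<longlongrightarrow> G \<mu>) (at 0)"
proof (rule continuous_within_tendsto_compose[OF assms(3) eventually_line_in_manifold[OF assms(1,2)]])
  have "((\<lambda>s. \<mu> + s *\<^sub>R u) \<longlongrightarrow> \<mu> + 0 *\<^sub>R u) (at 0)"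
    by (intro tendsto_intros)
  then show "((\<lambda>s. \<mu> + s *\<^sub>R u) \<longlongrightarrow> \<mu>) (at 0)"
    by simp
qed

text \<open>
  Since every tangent direction is realised by a segment inside the manifold, tangential values of
  a derivative are limits of difference quotients, and hence determined by the function.
\<close>

lemma derivative_along_line:
  fixes G :: "real ^ 'n \<Rightarrow> real"
  assumes \<mu>: "\<mu> \<in> prob_manifold" and u: "u \<in> tangent_space"
    and G: "(G has_derivative G') (at \<mu> within prob_manifold)"
  shows "((\<lambda>s. (G (\<mu> + s *\<^sub>R u) - G \<mu>) / s) \<longlongrightarrow> G' u) (at 0)"
proof -
  define L where "L s = \<mu> + s *\<^sub>R u" for s
  define S where "S = {s. L s \<in> prob_manifold}"
  have "(L has_derivative (\<lambda>s. s *\<^sub>R u)) (at 0 within S)"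
    unfolding L_def by (auto intro!: derivative_eq_intros)
  moreover have "(G has_derivative G') (at (L 0) within L ` S)"
    using has_derivative_subset[OF G, of "L ` S"] by (auto simp: S_def L_def)
  ultimately have "((\<lambda>s. G (L s)) has_derivative (\<lambda>s. G' (s *\<^sub>R u))) (at 0 within S)"
    by (rule has_derivative_in_compose)
  moreover have "G' (s *\<^sub>R u) = G' u * s" for s
    using linear_cmul[OF has_derivative_linear[OF G], of s u] by simp
  ultimately have "((\<lambda>s. G (L s)) has_field_derivative G' u) (at 0 within S)"
    by (simp add: has_field_derivative_def)
  moreover have "at 0 within S = at 0"
    using eventually_line_in_manifold[OF \<mu> u]
    by (auto simp: S_def L_def filter_eq_iff eventually_at_filter elim: eventually_elim2)
  ultimately show ?thesis
    using \<mu> by (simp add: has_field_derivative_iff L_def)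
qed

lemma has_derivative_differential:
  assumes "G differentiable (at \<mu> within prob_manifold)"
  shows "(G has_derivative differential G \<mu>) (at \<mu> within prob_manifold)"
  using assms unfolding differential_def by (simp add: frechet_derivative_works)

lemma differential_eqI:
  fixes G :: "real ^ 'n \<Rightarrow> real"
  assumes "\<mu> \<in> prob_manifold" "u \<in> tangent_space"
    and G: "(G has_derivative G') (at \<mu> within prob_manifold)"
  shows "differential G \<mu> u = G' u"
proof (rule tendsto_unique)
  have "(G has_derivative differential G \<mu>) (at \<mu> within prob_manifold)"
    using G by (intro has_derivative_differential) (auto simp: differentiable_def)
  then show "((\<lambda>s. (G (\<mu> + s *\<^sub>R u) - G \<mu>) / s) \<longlongrightarrow> differential G \<mu> u) (at 0)"
    using assms by (intro derivative_along_line)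
  show "((\<lambda>s. (G (\<mu> + s *\<^sub>R u) - G \<mu>) / s) \<longlongrightarrow> G' u) (at 0)"
    using assms by (intro derivative_along_line)
qed simp

section \<open>The relative entropy\<close>

lemma differential_relative_entropy:
  fixes \<pi> :: "real ^ 'n"
  assumes \<pi>: "\<And>i. \<pi> $ i > 0" and \<mu>: "\<mu> \<in> prob_manifold" and v: "v \<in> tangent_space"
  shows "differential (relative_entropy \<pi>) \<mu> v = (\<Sum>i\<in>UNIV. v $ i * ln (\<mu> $ i / \<pi> $ i))"
proof -
  have pos: "\<mu> $ i > 0" for i
    using \<mu> by (simp add: prob_manifold_def)
  have summand: "((\<lambda>\<rho>. \<rho> $ i * ln (\<pi> $ i / \<rho> $ i)) has_derivative
      (\<lambda>v. - (v $ i * (ln (\<mu> $ i / \<pi> $ i) + 1)))) (at \<mu> within prob_manifold)" for i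
  proof -
    have "((\<lambda>\<rho>. ln (\<pi> $ i / \<rho> $ i)) has_derivative (\<lambda>v. - (v $ i / \<mu> $ i)))
        (at \<mu> within prob_manifold)"
      using \<pi>[of i] pos[of i]
      by (auto intro!: derivative_eq_intros bounded_linear_imp_has_derivative
          simp: field_simps power2_eq_square)
    then have "((\<lambda>\<rho>. \<rho> $ i * ln (\<pi> $ i / \<rho> $ i)) has_derivative
        (\<lambda>v. \<mu> $ i * - (v $ i / \<mu> $ i) + v $ i * ln (\<pi> $ i / \<mu> $ i))) (at \<mu> within prob_manifold)"
      by (intro has_derivative_mult bounded_linear_imp_has_derivative bounded_linear_vec_nth)
    moreover have "(\<lambda>v. \<mu> $ i * - (v $ i / \<mu> $ i) + v $ i * ln (\<pi> $ i / \<mu> $ i))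
        = (\<lambda>v. - (v $ i * (ln (\<mu> $ i / \<pi> $ i) + 1)))"
      using \<pi>[of i] pos[of i] by (auto simp: ln_div fun_eq_iff algebra_simps)
    ultimately show ?thesis
      by simp
  qed
  have "(relative_entropy \<pi> has_derivative
      (\<lambda>v. - (\<Sum>i\<in>UNIV. - (v $ i * (ln (\<mu> $ i / \<pi> $ i) + 1))))) (at \<mu> within prob_manifold)"
    unfolding relative_entropy_def[abs_def]
    by (intro has_derivative_minus has_derivative_sum summand)
  from differential_eqI[OF \<mu> v this] show ?thesis
    using v by (simp add: tangent_space_def sum_negf sum_subtractf sum.distrib algebra_simps)
qed

lemma second_differential_relative_entropy:
  fixes \<pi> :: "real ^ 'n"
  assumes \<pi>: "\<pi> \<in> prob_manifold" and v: "v \<in> tangent_space" and w: "w \<in> tangent_space"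
  shows "second_differential (relative_entropy \<pi>) \<pi> v w = weighted_inner \<pi> v w"
proof -
  have pos: "\<pi> $ i > 0" for i
    using \<pi> by (simp add: prob_manifold_def)
  have summand: "((\<lambda>\<nu>. w $ i * ln (\<nu> $ i / \<pi> $ i)) has_derivative
      (\<lambda>v. v $ i * w $ i / \<pi> $ i)) (at \<pi> within prob_manifold)" for i
    using pos[of i]
    by (auto intro!: derivative_eq_intros bounded_linear_imp_has_derivative simp: field_simps)
  have "((\<lambda>\<nu>. \<Sum>i\<in>UNIV. w $ i * ln (\<nu> $ i / \<pi> $ i)) has_derivative (\<lambda>v. weighted_inner \<pi> v w))
      (at \<pi> within prob_manifold)"
    unfolding weighted_inner_def by (intro has_derivative_sum summand)
  from has_derivative_transform[OF \<pi> differential_relative_entropy[OF pos _ w] this]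
  have "((\<lambda>\<nu>. differential (relative_entropy \<pi>) \<nu> w) has_derivative
      (\<lambda>v. weighted_inner \<pi> v w)) (at \<pi> within prob_manifold)" .
  then show ?thesis
    unfolding second_differential_def by (rule differential_eqI[OF \<pi> v])
qed

section \<open>The initial velocity of the semigroup\<close>

lemma matrix_mult_funpow_scaleR:
  fixes Q X :: "real ^ 'n ^ 'n"
  shows "((**) (t *\<^sub>R Q) ^^ k) X = t ^ k *\<^sub>R ((**) Q ^^ k) X"
  by (induction k) (auto simp: matrix_scalar_ac mult.commute simp flip: scalar_matrix_assoc)

lemma summable_matrix_exp:
  fixes A :: "real ^ 'n ^ 'n"
  shows "summable (\<lambda>k. (1 / fact k) *\<^sub>R ((**) A ^^ k) (mat 1))"
proof -
  have "linear ((**) A)"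
    by (rule linearI) (auto simp: matrix_add_ldistrib matrix_scalar_ac scalar_matrix_assoc)
  then obtain C where C: "C > 0" "\<And>X :: real ^ 'n ^ 'n. norm (A ** X) \<le> norm X * C"
    using bounded_linear.pos_bounded linear_conv_bounded_linear by blast
  have bound: "norm (((**) A ^^ k) (mat 1)) \<le> norm (mat 1 :: real ^ 'n ^ 'n) * C ^ k" for k
  proof (induction k)
    case (Suc k)
    have "norm (A ** ((**) A ^^ k) (mat 1)) \<le> norm (((**) A ^^ k) (mat 1)) * C"
      by (rule C)
    also have "\<dots> \<le> norm (mat 1 :: real ^ 'n ^ 'n) * C ^ k * C"
      using Suc C(1) by (intro mult_right_mono) auto
    finally show ?case
      by (simp add: mult_ac)
  qed simp
  show ?thesis
  proof (rule summable_comparison_test')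
    show "summable (\<lambda>k. norm (mat 1 :: real ^ 'n ^ 'n) * (C ^ k /\<^sub>R fact k))"
      by (intro summable_mult summable_exp_generic)
    show "norm ((1 / fact k) *\<^sub>R ((**) A ^^ k) (mat 1))
        \<le> norm (mat 1 :: real ^ 'n ^ 'n) * (C ^ k /\<^sub>R fact k)" for k
      using bound[of k] by (simp add: field_simps)
  qed
qed

text \<open>
  Each entry of \<open>e\<^sup>t\<^sup>Q\<close> is an everywhere convergent power series in \<open>t\<close>, whose derivative at \<open>0\<close> is
  its linear coefficient.
\<close>

lemma matrix_exp_entry_derivative_0:
  fixes Q :: "real ^ 'n ^ 'n"
  shows "((\<lambda>t. matrix_exp (t *\<^sub>R Q) $ i $ j) has_real_derivative Q $ i $ j) (at 0)"
proof -
  define c where "c k = (1 / fact k) * (((**) Q ^^ k) (mat 1) $ i $ j)" for k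
  have entry: "bounded_linear (\<lambda>X :: real ^ 'n ^ 'n. X $ i $ j)"
    using bounded_linear_compose[OF bounded_linear_vec_nth bounded_linear_vec_nth] .
  have term_eq: "((1 / fact k) *\<^sub>R ((**) (t *\<^sub>R Q) ^^ k) (mat 1)) $ i $ j = c k * t ^ k" for k t
    by (simp add: matrix_mult_funpow_scaleR c_def)
  have power_series: "matrix_exp (t *\<^sub>R Q) $ i $ j = (\<Sum>k. c k * t ^ k)" for t
    using bounded_linear.suminf[OF entry summable_matrix_exp[of "t *\<^sub>R Q"]]
    unfolding matrix_exp_def term_eq by simp
  have "summable (\<lambda>k. c k * t ^ k)" for t
    using bounded_linear.summable[OF entry summable_matrix_exp[of "t *\<^sub>R Q"]]
    unfolding term_eq .
  from this[of 1] have "((\<lambda>t. \<Sum>k. c k * t ^ k) has_real_derivative (\<Sum>k. diffs c k * 0 ^ k)) (at 0)"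
    by (intro termdiffs_strong[where K = 1]) auto
  moreover have "(\<Sum>k. diffs c k * 0 ^ k) = Q $ i $ j"
    unfolding powser_zero by (simp add: diffs_def c_def)
  ultimately show ?thesis
    by (simp add: power_series)
qed

lemma semigroup_velocity_0:
  fixes Q :: "real ^ 'n ^ 'n"
  assumes "((\<lambda>t. \<mu> v* matrix_exp (t *\<^sub>R Q)) has_vector_derivative \<rho>') (at 0 within {0..})"
  shows "\<rho>' = \<mu> v* Q"
proof -
  have "\<rho>' $ j = (\<mu> v* Q) $ j" for j
  proof (rule vector_derivative_unique_within)
    show "at (0 :: real) within {0..} \<noteq> bot"
      by (simp add: at_within_Ici_at_right)
    show "((\<lambda>t. (\<mu> v* matrix_exp (t *\<^sub>R Q)) $ j) has_vector_derivative \<rho>' $ j) (at 0 within {0..})"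
      using bounded_linear.has_vector_derivative[OF bounded_linear_vec_nth assms] .
    have "((\<lambda>t. (\<mu> v* matrix_exp (t *\<^sub>R Q)) $ j) has_real_derivative (\<mu> v* Q) $ j) (at 0 within {0..})"
      unfolding vector_matrix_mult_def vec_lambda_beta
      by (rule has_field_derivative_at_within)
        (intro DERIV_sum DERIV_cmult[OF matrix_exp_entry_derivative_0])
    then show "((\<lambda>t. (\<mu> v* matrix_exp (t *\<^sub>R Q)) $ j) has_vector_derivative (\<mu> v* Q) $ j)
        (at 0 within {0..})"
      by (simp add: has_real_derivative_iff_has_vector_derivative)
  qed
  then show ?thesis
    by (simp add: vec_eq_iff)
qed

lemma matrix_exp_0: "matrix_exp (0 :: real ^ 'n ^ 'n) = mat 1"
proof -
  have zero: "((**) (0 :: real ^ 'n ^ 'n) ^^ k) (mat 1) = 0" if "k \<noteq> 0" for k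
    using that by (cases k) (auto simp: matrix_matrix_mult_def vec_eq_iff)
  have "matrix_exp (0 :: real ^ 'n ^ 'n)
      = (\<Sum>k\<in>{0}. (1 / fact k) *\<^sub>R ((**) (0 :: real ^ 'n ^ 'n) ^^ k) (mat 1))"
    unfolding matrix_exp_def by (rule suminf_finite) (auto simp: zero)
  then show ?thesis
    by simp
qed

lemma gradient_flow_equation:
  fixes Q :: "real ^ 'n ^ 'n"
  assumes "gradient_flow_equals_semigroup F g Q" "\<mu> \<in> prob_manifold" "v \<in> tangent_space"
  shows "g \<mu> (\<mu> v* Q) v = - differential F \<mu> v"
proof -
  have start: "\<mu> v* matrix_exp (0 *\<^sub>R Q) = \<mu>"
    by (simp add: matrix_exp_0)
  have "gradient_flow F g (\<lambda>t. \<mu> v* matrix_exp (t *\<^sub>R Q))"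
    using assms(1,2) by (simp add: gradient_flow_equals_semigroup_def)
  then obtain \<rho>' where
    "((\<lambda>t. \<mu> v* matrix_exp (t *\<^sub>R Q)) has_vector_derivative \<rho>') (at 0 within {0..})"
    "g (\<mu> v* matrix_exp (0 *\<^sub>R Q)) \<rho>' v = - differential F (\<mu> v* matrix_exp (0 *\<^sub>R Q)) v"
    using assms(3) unfolding gradient_flow_def by (metis order_refl)
  then show ?thesis
    using semigroup_velocity_0 start by metis
qed

section \<open>The metric at the stationary distribution\<close>

lemma vector_matrix_mult_in_tangent_space:
  fixes Q :: "real ^ 'n ^ 'n"
  assumes "generator Q"
  shows "u v* Q \<in> tangent_space"
proof -
  have row_sum: "(\<Sum>j\<in>UNIV. Q $ i $ j) = 0" for i
    using assms sum.remove[of UNIV i "\<lambda>j. Q $ i $ j"] by (simp add: generator_def)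
  have "(\<Sum>j\<in>UNIV. \<Sum>i\<in>UNIV. u $ i * Q $ i $ j) = (\<Sum>i\<in>UNIV. u $ i * (\<Sum>j\<in>UNIV. Q $ i $ j))"
    by (subst sum.swap) (simp add: sum_distrib_left)
  then show ?thesis
    by (simp add: tangent_space_def vector_matrix_mult_def row_sum)
qed

lemma differential_at_stationary_point:
  fixes Q :: "real ^ 'n ^ 'n"
  assumes "\<pi> \<in> prob_manifold" "stationary \<pi> Q" "riemannian_metric g"
    and "gradient_flow_equals_semigroup F g Q" "v \<in> tangent_space"
  shows "differential F \<pi> v = 0"
proof -
  have "g \<pi> 0 v = 0"
    using assms(1,3,5) inner_product_on_laws(6)[OF _ subspace_tangent_space, of "g \<pi>" v v v]
    by (simp add: riemannian_metric_def)
  then show ?thesis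
    using gradient_flow_equation[OF assms(4,1,5)] assms(2) by (simp add: stationary_def)
qed

text \<open>
  The flow equation at \<open>\<pi> + su\<close> reads \<open>s \<cdot> g(uQ, v) = - dF(v)\<close>, and \<open>dF(v)\<close> vanishes at \<open>\<pi>\<close>. Hence
  \<open>- g(uQ, v)\<close> at \<open>\<pi> + su\<close> is the difference quotient of \<open>dF(v)\<close>. The limit of the
  left-hand side follows from the continuity of the metric at \<open>\<pi>\<close>.
\<close>

lemma metric_at_stationary_point:
  fixes Q :: "real ^ 'n ^ 'n"
  assumes \<pi>: "\<pi> \<in> prob_manifold" and F: "class_C 2 F"
    and Q: "generator Q" "stationary \<pi> Q"
    and g: "riemannian_metric g" "metric_class_C 1 g"
    and flow: "gradient_flow_equals_semigroup F g Q"
    and u: "u \<in> tangent_space" and v: "v \<in> tangent_space"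
  shows "g \<pi> (u v* Q) v = - second_differential F \<pi> u v"
proof -
  define f where "f \<mu> = differential F \<mu> v" for \<mu>
  note uQ = vector_matrix_mult_in_tangent_space[OF Q(1), of u]
  have "class_C 1 (\<lambda>\<mu>. g \<mu> (u v* Q) v)"
    using g(2) uQ v by (simp add: metric_class_C_def)
  then have "(\<lambda>\<mu>. g \<mu> (u v* Q) v) differentiable_on prob_manifold"
    by simp
  then have "continuous (at \<pi> within prob_manifold) (\<lambda>\<mu>. g \<mu> (u v* Q) v)"
    using \<pi> differentiable_imp_continuous_within by (auto simp: differentiable_on_def)
  from tendsto_along_line[OF \<pi> u this]
  have limit_g: "((\<lambda>s. - g (\<pi> + s *\<^sub>R u) (u v* Q) v) \<longlongrightarrow> - g \<pi> (u v* Q) v) (at 0)"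
    by (rule tendsto_minus)
  have "f differentiable_on prob_manifold"
    using F v unfolding f_def[abs_def] by (simp add: numeral_2_eq_2)
  then have "(f has_derivative differential f \<pi>) (at \<pi> within prob_manifold)"
    using \<pi> by (intro has_derivative_differential) (auto simp: differentiable_on_def)
  from derivative_along_line[OF \<pi> u this]
  have limit_f: "((\<lambda>s. (f (\<pi> + s *\<^sub>R u) - f \<pi>) / s) \<longlongrightarrow> second_differential F \<pi> u v) (at 0)"
    by (simp add: second_differential_def f_def[abs_def])
  have "f \<pi> = 0"
    unfolding f_def using differential_at_stationary_point[OF \<pi> Q(2) g(1) flow v] .
  have "\<forall>\<^sub>F s in at 0. (f (\<pi> + s *\<^sub>R u) - f \<pi>) / s = - g (\<pi> + s *\<^sub>R u) (u v* Q) v"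
    using eventually_line_in_manifold[OF \<pi> u] eventually_neq_at_within[of 0]
  proof eventually_elim
    case (elim s)
    have "(\<pi> + s *\<^sub>R u) v* Q = s *\<^sub>R (u v* Q)"
      using Q(2) by (simp add: stationary_def vector_matrix_left_distrib scaleR_vector_matrix_assoc)
    then have "g (\<pi> + s *\<^sub>R u) (s *\<^sub>R (u v* Q)) v = - f (\<pi> + s *\<^sub>R u)"
      using gradient_flow_equation[OF flow elim(1) v] by (simp add: f_def)
    moreover have "g (\<pi> + s *\<^sub>R u) (s *\<^sub>R (u v* Q)) v = s * g (\<pi> + s *\<^sub>R u) (u v* Q) v"
      using g(1) elim(1) uQ v by (simp add: riemannian_metric_def inner_product_on_def)
    ultimately show ?case
      using elim(2) \<open>f \<pi> = 0\<close> by (simp add: field_simps)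
  qed
  then have "((\<lambda>s. - g (\<pi> + s *\<^sub>R u) (u v* Q) v) \<longlongrightarrow> second_differential F \<pi> u v) (at 0)"
    using limit_f by (simp cong: tendsto_cong)
  then show ?thesis
    using tendsto_unique[OF _ limit_g] by fastforce
qed

section \<open>Rank-one perturbations of the complete chain\<close>

text \<open>
  For \<open>w = 0\<close> this chain jumps at rate \<open>K\<close> to a state drawn from \<open>\<pi>\<close>. The perturbation is
  symmetric with respect to \<open>\<pi>\<close>, which preserves detailed balance, and has vanishing row sums
  because \<open>w\<close> is tangent.
\<close>

definition rank_one_generator :: "real ^ 'n \<Rightarrow> real \<Rightarrow> real ^ 'n \<Rightarrow> real ^ 'n ^ 'n" where
  "rank_one_generator \<pi> K w =
     (\<chi> i j. K * (\<pi> $ j - (if i = j then 1 else 0)) + w $ i * w $ j / \<pi> $ i)"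

lemma vector_rank_one_generator:
  fixes \<pi> :: "real ^ 'n"
  shows "u v* rank_one_generator \<pi> K w
    = K *\<^sub>R ((\<Sum>i\<in>UNIV. u $ i) *\<^sub>R \<pi> - u) + weighted_inner \<pi> u w *\<^sub>R w"
proof -
  have "(\<Sum>i\<in>UNIV. u $ i * (K * (\<pi> $ j - (if i = j then 1 else 0)) + w $ i * w $ j / \<pi> $ i))
      = K * ((\<Sum>i\<in>UNIV. u $ i) * \<pi> $ j - (\<Sum>i\<in>UNIV. if i = j then u $ i else 0))
        + weighted_inner \<pi> u w * w $ j" for j
    unfolding weighted_inner_def sum_distrib_left sum_distrib_right sum_subtractf[symmetric]
      sum.distrib[symmetric]
    by (intro sum.cong) (auto simp: algebra_simps)
  then show ?thesis
    by (simp add: vec_eq_iff vector_matrix_mult_def rank_one_generator_def)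
qed

lemma vector_rank_one_generator_tangent:
  fixes \<pi> :: "real ^ 'n"
  assumes "u \<in> tangent_space"
  shows "u v* rank_one_generator \<pi> K w = (- K) *\<^sub>R u + weighted_inner \<pi> u w *\<^sub>R w"
  using assms by (simp add: vector_rank_one_generator tangent_space_def)

lemma stationary_rank_one_generator:
  fixes \<pi> :: "real ^ 'n"
  assumes \<pi>: "\<pi> \<in> prob_manifold" and w: "w \<in> tangent_space"
  shows "stationary \<pi> (rank_one_generator \<pi> K w)"
proof -
  have "\<pi> $ i \<noteq> 0" for i
    using \<pi> by (simp add: prob_manifold_def less_imp_neq[THEN not_sym])
  then have "weighted_inner \<pi> \<pi> w = 0"
    using w by (simp add: weighted_inner_def tangent_space_def)
  then show ?thesis
    using \<pi> by (simp add: stationary_def vector_rank_one_generator prob_manifold_def)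
qed

lemma detailed_balance_rank_one_generator:
  fixes \<pi> :: "real ^ 'n"
  assumes "\<pi> \<in> prob_manifold"
  shows "detailed_balance \<pi> (rank_one_generator \<pi> K w)"
proof -
  have "\<pi> $ i \<noteq> 0" for i
    using assms by (simp add: prob_manifold_def less_imp_neq[THEN not_sym])
  then show ?thesis
    by (auto simp: detailed_balance_def rank_one_generator_def field_simps)
qed

lemma generator_rank_one_generator:
  fixes \<pi> :: "real ^ 'n"
  assumes \<pi>: "\<pi> \<in> prob_manifold" and w: "w \<in> tangent_space"
    and pos: "\<And>i j. i \<noteq> j \<Longrightarrow> rank_one_generator \<pi> K w $ i $ j > 0"
  shows "generator (rank_one_generator \<pi> K w)"
    and "irreducible_generator (rank_one_generator \<pi> K w)"
proof -
  let ?Q = "rank_one_generator \<pi> K w"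
  have "(\<Sum>j\<in>UNIV. ?Q $ i $ j) = 0" for i
  proof -
    have "(\<Sum>j\<in>UNIV. ?Q $ i $ j) = K * ((\<Sum>j\<in>UNIV. \<pi> $ j) - 1) + w $ i / \<pi> $ i * (\<Sum>j\<in>UNIV. w $ j)"
      by (simp add: rank_one_generator_def sum.distrib sum_subtractf
          flip: sum_distrib_left sum_divide_distrib)
    then show ?thesis
      using \<pi> w by (simp add: prob_manifold_def tangent_space_def)
  qed
  then have "?Q $ i $ i = - (\<Sum>j\<in>UNIV - {i}. ?Q $ i $ j)" for i
    using sum.remove[of UNIV i "\<lambda>j. ?Q $ i $ j"] by (simp add: add_eq_0_iff)
  then show "generator ?Q"
    using pos by (auto simp: generator_def intro: less_imp_le)
  have "(i, j) \<in> {(k, l). k \<noteq> l \<and> ?Q $ k $ l > 0}\<^sup>*" for i j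
    using pos by (cases "i = j") auto
  then show "irreducible_generator ?Q"
    by (simp add: irreducible_generator_def)
qed

text \<open>
  With \<open>x\<^sub>i = w\<^sub>i / \<pi>\<^sub>i\<close> the rate from \<open>i\<close> to \<open>j\<close> is \<open>\<pi>\<^sub>j (K + x\<^sub>i x\<^sub>j)\<close>, so it suffices that \<open>K\<close> exceeds
  \<open>\<parallel>x\<parallel>\<^sup>2\<close>.
\<close>

lemma rank_one_generator_rates_positive:
  fixes \<pi> :: "real ^ 'n"
  assumes \<pi>: "\<pi> \<in> prob_manifold" and K: "K > (norm (\<chi> i. w $ i / \<pi> $ i))\<^sup>2" and "i \<noteq> j"
  shows "rank_one_generator \<pi> K w $ i $ j > 0"
proof -
  define x where "x = (\<chi> i. w $ i / \<pi> $ i)"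
  have pos: "\<pi> $ i > 0" for i
    using \<pi> by (simp add: prob_manifold_def)
  have "\<bar>x $ i * x $ j\<bar> \<le> norm x * norm x"
    unfolding abs_mult by (intro mult_mono component_le_norm_cart) auto
  moreover have "K > norm x * norm x"
    using K by (simp add: x_def power2_eq_square)
  ultimately have "K + x $ i * x $ j > 0"
    by linarith
  moreover have "rank_one_generator \<pi> K w $ i $ j = \<pi> $ j * (K + x $ i * x $ j)"
    using pos[of i] pos[of j] \<open>i \<noteq> j\<close> by (simp add: rank_one_generator_def x_def field_simps)
  ultimately show ?thesis
    using pos by simp
qed

section \<open>Uniqueness of the entropy to second order\<close>

theorem theorem1p5:
  fixes \<pi> :: "real ^ 'n" and F :: "real ^ 'n \<Rightarrow> real"
  assumes "\<pi> \<in> prob_manifold"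
    and "class_C 2 F"
    and "\<And>Q :: real ^ 'n ^ 'n.
           \<lbrakk>generator Q; irreducible_generator Q; stationary \<pi> Q; detailed_balance \<pi> Q\<rbrakk> \<Longrightarrow>
           \<exists>g. riemannian_metric g \<and> metric_class_C 1 g \<and> gradient_flow_equals_semigroup F g Q"
  shows "\<exists>\<alpha>>0.
    (\<forall>v\<in>tangent_space. differential F \<pi> v = 0 \<and> differential (relative_entropy \<pi>) \<pi> v = 0) \<and>
    (\<forall>v\<in>tangent_space. \<forall>w\<in>tangent_space.
       second_differential F \<pi> v w = \<alpha> * second_differential (relative_entropy \<pi>) \<pi> v w)"
proof -
  note \<pi> = assms(1) and T = subspace_tangent_space
  define B where "B = second_differential F \<pi>"
  have pos: "\<pi> $ i > 0" for i
    using \<pi> by (simp add: prob_manifold_def)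
  have metric: "\<exists>h. inner_product_on tangent_space h \<and>
      (\<forall>v\<in>tangent_space. differential F \<pi> v = 0) \<and>
      (\<forall>u\<in>tangent_space. \<forall>v\<in>tangent_space.
         h ((- K) *\<^sub>R u + weighted_inner \<pi> u w *\<^sub>R w) v = - B u v)"
    if w: "w \<in> tangent_space" and K: "K > (norm (\<chi> i. w $ i / \<pi> $ i))\<^sup>2" for K w
  proof -
    let ?Q = "rank_one_generator \<pi> K w"
    have Q: "generator ?Q" "irreducible_generator ?Q" "stationary \<pi> ?Q" "detailed_balance \<pi> ?Q"
      using generator_rank_one_generator[OF \<pi> w rank_one_generator_rates_positive[OF \<pi> K]]
        stationary_rank_one_generator[OF \<pi> w] detailed_balance_rank_one_generator[OF \<pi>]
      by blast+
    from assms(3)[OF this] obtain g where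
      g: "riemannian_metric g" "metric_class_C 1 g" "gradient_flow_equals_semigroup F g ?Q"
      by blast
    have "inner_product_on tangent_space (g \<pi>)"
      using g(1) \<pi> by (simp add: riemannian_metric_def)
    moreover have "g \<pi> ((- K) *\<^sub>R u + weighted_inner \<pi> u w *\<^sub>R w) v = - B u v"
      if "u \<in> tangent_space" "v \<in> tangent_space" for u v
      using metric_at_stationary_point[OF \<pi> assms(2) Q(1,3) g that]
        vector_rank_one_generator_tangent[OF that(1), of \<pi> K w] by (simp add: B_def)
    ultimately show ?thesis
      using differential_at_stationary_point[OF \<pi> Q(3) g(1,3)] by blast
  qed

  \<comment> \<open>The unperturbed chain acts on tangent vectors as \<open>- 1\<close>, so its metric at \<open>\<pi>\<close> is \<open>B\<close> itself.\<close>
  obtain h0 where h0: "inner_product_on tangent_space h0"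
    and dF: "\<forall>v\<in>tangent_space. differential F \<pi> v = 0"
    and h0_B: "\<forall>u\<in>tangent_space. \<forall>v\<in>tangent_space. h0 ((- 1) *\<^sub>R u) v = - B u v"
    using metric[of 0 1] subspace_0[OF T] by (auto simp: vec_eq_iff norm_eq_zero zero_vec_def[symmetric])
  have B_eq: "B u v = h0 u v" if "u \<in> tangent_space" "v \<in> tangent_space" for u v
    using inner_product_on_laws(3)[OF h0 T, of u u v "- 1"] h0_B that by simp
  then have B: "inner_product_on tangent_space B"
    by (rule inner_product_on_cong[OF h0 T])
  note B_laws = inner_product_on_laws[OF B T]

  have parallel: "weighted_inner \<pi> v w * B u w = weighted_inner \<pi> u w * B v w"
    if uvw: "u \<in> tangent_space" "v \<in> tangent_space" "w \<in> tangent_space" for u v w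
  proof -
    define K where "K = (norm (\<chi> i. w $ i / \<pi> $ i))\<^sup>2 + 1"
    define q where "q u = (- K) *\<^sub>R u + weighted_inner \<pi> u w *\<^sub>R w" for u
    obtain h where h: "inner_product_on tangent_space h"
      and h_B: "\<forall>u\<in>tangent_space. \<forall>v\<in>tangent_space. h (q u) v = - B u v"
      using metric[OF uvw(3), of K] by (auto simp: K_def q_def)
    have q: "q x \<in> tangent_space" if "x \<in> tangent_space" for x
      unfolding q_def using that uvw(3) by (intro subspace_add subspace_scale T)
    \<comment> \<open>Both sides equal \<open>- h (q u) (q v)\<close>, by the flow equation and the symmetry of \<open>h\<close>.\<close>
    have "B u (q v) = B v (q u)"
      using inner_product_on_laws(5)[OF h T, of "q u" "q u" "q v"] h_B q uvw by simp
    moreover have "B x (q y) = - K * B x y + weighted_inner \<pi> y w * B x w"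
      if "x \<in> tangent_space" "y \<in> tangent_space" for x y
    proof -
      have "B x (q y) = B x ((- K) *\<^sub>R y) + B x (weighted_inner \<pi> y w *\<^sub>R w)"
        unfolding q_def using that uvw(3) by (intro B_laws(2) subspace_scale T)
      then show ?thesis
        using B_laws(4)[OF that(2,2,1), of "- K"] B_laws(4)[OF uvw(3,3) that(1)] by simp
    qed
    moreover have "B u v = B v u"
      using B_laws(5) uvw by blast
    ultimately show ?thesis
      using uvw by simp
  qed

  obtain \<alpha> where \<alpha>: "\<alpha> > 0"
    "\<forall>u\<in>tangent_space. \<forall>w\<in>tangent_space. B u w = \<alpha> * weighted_inner \<pi> u w"
    using inner_products_proportional[OF T inner_product_on_weighted_inner[OF pos] B parallel]
    by blast
  have "differential (relative_entropy \<pi>) \<pi> v = 0" if "v \<in> tangent_space" for v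
    using differential_relative_entropy[OF pos \<pi> that] pos less_imp_neq[OF pos] by simp
  then show ?thesis
    using \<alpha> dF second_differential_relative_entropy[OF \<pi>] by (auto simp: B_def)
qed

end
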